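(* For any set $\mathcal{X}$, any function class $\mathcal{F}\subseteq(\mathcal{X}\to\{1,-1\})$ and any $f^\star\in\mathcal{F}$, $$\max\{\mathsf{Sdim}_{f^\star}(\mathcal{F}),\mathsf{Tdim}_{f^\star}(\mathcal{F})\}\ \le\ \mathsf{Edim}_{f^\star}(\mathcal{F})\ \le\ 4^{\max\{\mathsf{Sdim}_{f^\star}(\mathcal{F}),\mathsf{Tdim}_{f^\star}(\mathcal{F})\}}.$$
   Context: For $\mathcal{F}\subseteq(\mathcal{X}\to\{1,-1\})$ and $f^\star\in\mathcal{F}$, each of the following is the largest $m$ (possibly $\infty$) such that there exist $(x_1,f_1),\dots,(x_m,f_m)\in\mathcal{X}\times\mathcal{F}$ satisfying the stated condition for all $i\in\{1,\dots,m\}$. - Combinatorial eluder dimension $\mathsf{Edim}_{f^\star}(\mathcal{F})$: $f_i(x_i)\ne f^\star(x_i)$, and $f_i(x_j)=f^\star(x_j)$ for all $j<i$. - Star number $\mathsf{Sdim}_{f^\star}(\mathcal{F})$: $f_i(x_i)\ne f^\star(x_i)$, and $f_i(x_j)=f^\star(x_j)$ for all $j\ne i$. - Threshold dimension $\mathsf{Tdim}_{f^\star}(\mathcal{F})$: $f_i(x_k)\ne f^\star(x_k)$ for all $k\ge i$, and $f_i(x_j)=f^\star(x_j)$ for all $j<i$. *)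

theory Defs
  imports "HOL-Library.Extended_Nat" "HOL-Library.FuncSet"
begin

(* In each dimension below, m = 0 is always feasible, so the supremum is taken over a nonempty
   set of naturals: it is the maximum if there is one, and \<infinity> if arbitrarily large m are feasible. *)

definition Edim :: "'a set \<Rightarrow> ('a \<Rightarrow> int) set \<Rightarrow> ('a \<Rightarrow> int) \<Rightarrow> enat" where
  "Edim X F fstar = Sup {enat m | m. \<exists>x f.
     (\<forall>i\<in>{1..m}. x i \<in> X \<and> f i \<in> F \<and>
        f i (x i) \<noteq> fstar (x i) \<and>
        (\<forall>j\<in>{1..m}. j < i \<longrightarrow> f i (x j) = fstar (x j)))}"

definition Sdim :: "'a set \<Rightarrow> ('a \<Rightarrow> int) set \<Rightarrow> ('a \<Rightarrow> int) \<Rightarrow> enat" where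
  "Sdim X F fstar = Sup {enat m | m. \<exists>x f.
     (\<forall>i\<in>{1..m}. x i \<in> X \<and> f i \<in> F \<and>
        f i (x i) \<noteq> fstar (x i) \<and>
        (\<forall>j\<in>{1..m}. j \<noteq> i \<longrightarrow> f i (x j) = fstar (x j)))}"

definition Tdim :: "'a set \<Rightarrow> ('a \<Rightarrow> int) set \<Rightarrow> ('a \<Rightarrow> int) \<Rightarrow> enat" where
  "Tdim X F fstar = Sup {enat m | m. \<exists>x f.
     (\<forall>i\<in>{1..m}. x i \<in> X \<and> f i \<in> F \<and>
        (\<forall>k\<in>{1..m}. k \<ge> i \<longrightarrow> f i (x k) \<noteq> fstar (x k)) \<and>
        (\<forall>j\<in>{1..m}. j < i \<longrightarrow> f i (x j) = fstar (x j)))}"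

(* Powers with an exponent in enat, with the convention b ^ \<infinity> = \<infinity>; intended for b \<ge> 2 only. *)
definition enat_pow :: "nat \<Rightarrow> enat \<Rightarrow> enat" where
  "enat_pow b e = (case e of enat n \<Rightarrow> enat (b ^ n) | \<infinity> \<Rightarrow> \<infinity>)"

end

theory Submission
  imports Defs "HOL-Library.Infinite_Set"
begin

text \<open>Given an eluder sequence, colour a pair \<open>i < j\<close> by whether \<open>f i (x j) = fstar (x j)\<close>. The
  subsequence indexed by a monochromatic set is a star or a threshold sequence, according to the
  colour, so Ramsey's theorem with the bound \<open>R(a + 1, b + 1) \<le> 2 ^ (a + b)\<close> gives the upper
  estimate.\<close>

text \<open>Induction on \<open>a + b\<close>: the least element \<open>v\<close> of
  \<open>A\<close> splits the other elements \<open>w\<close> by the truth of \<open>P v w\<close>,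
  and one of the two parts is large enough for the induction hypothesis. Choosing the minimum makes
  \<open>v\<close> the smaller member of each pair containing it, so \<open>P\<close> need not be
  symmetric.\<close>

lemma ramsey_ordered_pairs:
  fixes A :: "'i::linorder set" and P :: "'i \<Rightarrow> 'i \<Rightarrow> bool"
  assumes "finite A" and "2 ^ (a + b) \<le> card A"
  shows "(\<exists>B\<subseteq>A. card B = Suc a \<and> (\<forall>i\<in>B. \<forall>j\<in>B. i < j \<longrightarrow> P i j)) \<or>
         (\<exists>B\<subseteq>A. card B = Suc b \<and> (\<forall>i\<in>B. \<forall>j\<in>B. i < j \<longrightarrow> \<not> P i j))"
  using assms
proof (induction "a + b" arbitrary: a b A rule: less_induct)
  case less
  have "card A \<noteq> 0"
    using less.prems(2) by (metis le_zero_eq power_not_zero zero_neq_numeral)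
  then have "A \<noteq> {}" by auto
  define v where "v = Min A"
  have v: "v \<in> A" "\<And>w. w \<in> A \<Longrightarrow> \<not> w < v"
    using \<open>finite A\<close> \<open>A \<noteq> {}\<close> by (auto simp: v_def not_less)
  show ?case
  proof (cases "a = 0 \<or> b = 0")
    case True
    \<comment> \<open>A singleton contains no pair \<open>i < j\<close>, so it is homogeneous for
      either colour.\<close>
    have "{v} \<subseteq> A" "card {v} = Suc 0" using v by auto
    then show ?thesis using True by (metis order_less_irrefl singletonD)
  next
    case False
    then obtain a' b' where ab: "a = Suc a'" "b = Suc b'"
      by (meson not0_implies_Suc)
    define C where "C = {w \<in> A - {v}. P v w}"
    define D where "D = {w \<in> A - {v}. \<not> P v w}"
    have fin: "finite C" "finite D" using \<open>finite A\<close> by (auto simp: C_def D_def)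
    have "A - {v} = C \<union> D" "C \<inter> D = {}" by (auto simp: C_def D_def)
    then have "card A - 1 = card C + card D"
      using fin v(1) by (metis card_Diff_singleton card_Un_disjoint)
    \<comment> \<open>Both bounds equal half of \<open>2 ^ (a + b)\<close>. If both failed,
      \<open>card C + card D\<close> would be at most \<open>2 ^ (a + b) - 2\<close>, which is less
      than \<open>card A - 1\<close>.\<close>
    then have "2 ^ (a' + b) \<le> card C \<or> 2 ^ (a + b') \<le> card D"
      using less.prems(2) by (simp add: ab) linarith
    then show ?thesis
    proof
      assume "2 ^ (a' + b) \<le> card C"
      with less.hyps[of a' b C] fin ab consider
        B where "B \<subseteq> C" "card B = a" "\<forall>i\<in>B. \<forall>j\<in>B. i < j \<longrightarrow> P i j"
        | B where "B \<subseteq> C" "card B = Suc b" "\<forall>i\<in>B. \<forall>j\<in>B. i < j \<longrightarrow> \<not> P i j"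
        by auto
      then show ?thesis
      proof cases
        case 1
        then have "insert v B \<subseteq> A" "v \<notin> B" "finite B"
          using v(1) fin(1) by (auto simp: C_def dest: finite_subset)
        \<comment> \<open>New pairs have \<open>v\<close> in first place, where membership in
          \<open>C\<close> gives \<open>P v w\<close>; nothing in \<open>A\<close> lies below
          \<open>v\<close>.\<close>
        moreover have "\<forall>i\<in>insert v B. \<forall>j\<in>insert v B. i < j \<longrightarrow> P i j"
          using 1(1,3) v(2) by (auto simp: C_def subset_iff)
        ultimately show ?thesis using 1(2) by (metis card_insert_disjoint)
      next
        case 2
        then have "B \<subseteq> A" by (auto simp: C_def)
        then show ?thesis using 2 by blast
      qed
    next
      assume "2 ^ (a + b') \<le> card D"
      with less.hyps[of a b' D] fin ab consider
        B where "B \<subseteq> D" "card B = Suc a" "\<forall>i\<in>B. \<forall>j\<in>B. i < j \<longrightarrow> P i j"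
        | B where "B \<subseteq> D" "card B = b" "\<forall>i\<in>B. \<forall>j\<in>B. i < j \<longrightarrow> \<not> P i j"
        by auto
      then show ?thesis
      proof cases
        case 1
        then have "B \<subseteq> A" by (auto simp: D_def)
        then show ?thesis using 1 by blast
      next
        case 2
        then have "insert v B \<subseteq> A" "v \<notin> B" "finite B"
          using v(1) fin(2) by (auto simp: D_def dest: finite_subset)
        moreover have "\<forall>i\<in>insert v B. \<forall>j\<in>insert v B. i < j \<longrightarrow> \<not> P i j"
          using 2(1,3) v(2) by (auto simp: D_def subset_iff)
        ultimately show ?thesis using 2(2) by (metis card_insert_disjoint)
      qed
    qed
  qed
qed

text \<open>Used to re-index a subset of positions by an initial segment, as the dimensions demand,
  without changing their order.\<close>

lemma strict_mono_enumeration: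
  fixes B :: "nat set"
  assumes "finite B"
  obtains h where "h ` {1..card B} = B"
    and "\<And>i j. \<lbrakk>i \<in> {1..card B}; j \<in> {1..card B}\<rbrakk> \<Longrightarrow> h i < h j \<longleftrightarrow> i < j"
proof -
  obtain g where g: "bij_betw g {..<card B} B" "strict_mono_on {..<card B} g"
    using ex_bij_betw_strict_mono_card[OF assms] by blast
  show ?thesis
  \<comment> \<open>The shift is needed because \<open>g\<close> counts from 0, the sequences from
    1.\<close>
  proof (rule that[of "\<lambda>i. g (i - 1)"])
    have "{1..card B} = Suc ` {..<card B}"
      by (simp add: image_Suc_lessThan)
    then show "(\<lambda>i. g (i - 1)) ` {1..card B} = B"
      using g(1) by (simp add: bij_betw_def image_image del: One_nat_def)
    fix i j
    assume ij: "i \<in> {1..card B}" "j \<in> {1..card B}"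
    then have "i - 1 \<in> {..<card B}" "j - 1 \<in> {..<card B}" by auto
    from strict_mono_on_less[OF g(2) this] ij
    show "g (i - 1) < g (j - 1) \<longleftrightarrow> i < j" by auto
  qed
qed

text \<open>Composing \<open>x\<close> and \<open>f\<close> with the enumeration \<open>h\<close> of
  \<open>B\<close> gives a star sequence. The star condition ignores order, so injectivity of
  \<open>h\<close> is enough.\<close>

lemma card_le_Sdim:
  fixes B :: "nat set"
  assumes "finite B"
    and "\<And>i. i \<in> B \<Longrightarrow> x i \<in> X \<and> f i \<in> F \<and> f i (x i) \<noteq> fstar (x i)"
    and "\<And>i j. \<lbrakk>i \<in> B; j \<in> B; j \<noteq> i\<rbrakk> \<Longrightarrow> f i (x j) = fstar (x j)"
  shows "enat (card B) \<le> Sdim X F fstar"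
proof -
  obtain h where h: "h ` {1..card B} = B"
    and mono: "\<And>i j. \<lbrakk>i \<in> {1..card B}; j \<in> {1..card B}\<rbrakk> \<Longrightarrow> h i < h j \<longleftrightarrow> i < j"
    using strict_mono_enumeration[OF assms(1)] by metis
  have "h i \<in> B" if "i \<in> {1..card B}" for i using h that by blast
  moreover have "h i \<noteq> h j" if "i \<in> {1..card B}" "j \<in> {1..card B}" "i \<noteq> j" for i j
    using mono that by (metis linorder_neqE_nat order_less_irrefl)
  ultimately show ?thesis
    unfolding Sdim_def using assms(2,3)
    by (intro Sup_upper CollectI exI[of _ "card B"] conjI refl exI[of _ "x \<circ> h"] exI[of _ "f \<circ> h"])
      (simp add: comp_def)
qed

text \<open>As for stars, but the threshold condition compares indices, so \<open>h\<close> has to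
  preserve order.\<close>

lemma card_le_Tdim:
  fixes B :: "nat set"
  assumes "finite B"
    and "\<And>i. i \<in> B \<Longrightarrow> x i \<in> X \<and> f i \<in> F"
    and "\<And>i k. \<lbrakk>i \<in> B; k \<in> B; i \<le> k\<rbrakk> \<Longrightarrow> f i (x k) \<noteq> fstar (x k)"
    and "\<And>i j. \<lbrakk>i \<in> B; j \<in> B; j < i\<rbrakk> \<Longrightarrow> f i (x j) = fstar (x j)"
  shows "enat (card B) \<le> Tdim X F fstar"
proof -
  obtain h where h: "h ` {1..card B} = B"
    and mono: "\<And>i j. \<lbrakk>i \<in> {1..card B}; j \<in> {1..card B}\<rbrakk> \<Longrightarrow> h i < h j \<longleftrightarrow> i < j"
    using strict_mono_enumeration[OF assms(1)] by metis
  have "h i \<in> B" if "i \<in> {1..card B}" for i using h that by blast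
  moreover have "h i \<le> h k" if "i \<in> {1..card B}" "k \<in> {1..card B}" "i \<le> k" for i k
    using mono that by (metis leD leI)
  ultimately show ?thesis
    unfolding Tdim_def using assms(2-4) mono
    by (intro Sup_upper CollectI exI[of _ "card B"] conjI refl exI[of _ "x \<circ> h"] exI[of _ "f \<circ> h"])
      (simp add: comp_def)
qed

lemma Sdim_le_Edim: "Sdim X F fstar \<le> Edim X F fstar"
  unfolding Sdim_def
proof (rule Sup_least, clarify)
  fix m :: nat and x f
  assume "\<forall>i\<in>{1..m}. x i \<in> X \<and> f i \<in> F \<and>
    f i (x i) \<noteq> fstar (x i) \<and> (\<forall>j\<in>{1..m}. j \<noteq> i \<longrightarrow> f i (x j) = fstar (x j))"
  then show "enat m \<le> Edim X F fstar"
    unfolding Edim_def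
    by (intro Sup_upper CollectI exI[of _ m] conjI refl exI[of _ x] exI[of _ f]) simp
qed

lemma Tdim_le_Edim: "Tdim X F fstar \<le> Edim X F fstar"
  unfolding Tdim_def
proof (rule Sup_least, clarify)
  fix m :: nat and x f
  assume "\<forall>i\<in>{1..m}. x i \<in> X \<and> f i \<in> F \<and>
    (\<forall>k\<in>{1..m}. k \<ge> i \<longrightarrow> f i (x k) \<noteq> fstar (x k)) \<and>
    (\<forall>j\<in>{1..m}. j < i \<longrightarrow> f i (x j) = fstar (x j))"
  then show "enat m \<le> Edim X F fstar"
    unfolding Edim_def
    \<comment> \<open>The instance \<open>k = i\<close> of the threshold condition gives
      \<open>f i (x i) \<noteq> fstar (x i)\<close>.\<close>
    by (intro Sup_upper CollectI exI[of _ m] conjI refl exI[of _ x] exI[of _ f]) simp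
qed

lemma Edim_le_four_power:
  assumes "Sdim X F fstar \<le> enat d" and "Tdim X F fstar \<le> enat d"
  shows "Edim X F fstar \<le> enat (4 ^ d)"
  unfolding Edim_def
proof (rule Sup_least, clarify)
  fix m :: nat and x f
  assume eluder: "\<forall>i\<in>{1..m}. x i \<in> X \<and> f i \<in> F \<and> f i (x i) \<noteq> fstar (x i) \<and>
    (\<forall>j\<in>{1..m}. j < i \<longrightarrow> f i (x j) = fstar (x j))"
  show "enat m \<le> enat (4 ^ d)"
  proof (rule ccontr)
    assume "\<not> ?thesis"
    \<comment> \<open>Since \<open>4 ^ d = 2 ^ (d + d)\<close>, Ramsey applies with
      \<open>a = b = d\<close>; a homogeneous set of size \<open>d + 1\<close> then exceeds the
      bound on one of the two dimensions.\<close>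
    then have "2 ^ (d + d) \<le> card {1..m}"
      by (simp add: power_add flip: power_mult_distrib)
    from ramsey_ordered_pairs[OF _ this, where P = "\<lambda>i j. f i (x j) = fstar (x j)"]
    consider
      B where "B \<subseteq> {1..m}" "card B = Suc d"
        "\<forall>i\<in>B. \<forall>j\<in>B. i < j \<longrightarrow> f i (x j) = fstar (x j)"
      | B where "B \<subseteq> {1..m}" "card B = Suc d"
        "\<forall>i\<in>B. \<forall>j\<in>B. i < j \<longrightarrow> f i (x j) \<noteq> fstar (x j)"
      by auto
    then show False
    proof cases
      case 1
      \<comment> \<open>Agreement at \<open>x j\<close> comes from the eluder property for
        \<open>j < i\<close> and from the colour for \<open>i < j\<close>.\<close>
      have "finite B" using 1(1) finite_subset by blast
      then have "enat (card B) \<le> Sdim X F fstar"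
        using eluder 1 by (intro card_le_Sdim[of B x X f F])
          (auto simp: subset_iff neq_iff)
      then show False using 1(2) assms(1) by (metis enat_ord_simps(1) not_less_eq_eq order_refl order_trans)
    next
      case 2
      \<comment> \<open>Disagreement at \<open>x k\<close> comes from the eluder property for
        \<open>k = i\<close> and from the colour for \<open>i < k\<close>.\<close>
      have "finite B" using 2(1) finite_subset by blast
      then have "enat (card B) \<le> Tdim X F fstar"
        using eluder 2 by (intro card_le_Tdim[of B x X f F])
          (auto simp: subset_iff le_less)
      then show False using 2(2) assms(2) by (metis enat_ord_simps(1) not_less_eq_eq order_refl order_trans)
    qed
  qed
qed

theorem theorem8:
  fixes X :: "'a set" and F :: "('a \<Rightarrow> int) set" and fstar :: "'a \<Rightarrow> int"
  assumes "F \<subseteq> X \<rightarrow>\<^sub>E {1, -1}" and "fstar \<in> F"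
  shows "max (Sdim X F fstar) (Tdim X F fstar) \<le> Edim X F fstar \<and>
         Edim X F fstar \<le> enat_pow 4 (max (Sdim X F fstar) (Tdim X F fstar))"
proof
  show "max (Sdim X F fstar) (Tdim X F fstar) \<le> Edim X F fstar"
    by (simp add: Sdim_le_Edim Tdim_le_Edim)
  show "Edim X F fstar \<le> enat_pow 4 (max (Sdim X F fstar) (Tdim X F fstar))"
  proof (cases "max (Sdim X F fstar) (Tdim X F fstar)")
    case (enat d)
    then have "Sdim X F fstar \<le> enat d" "Tdim X F fstar \<le> enat d"
      by (metis max.cobounded1, metis max.cobounded2)
    then show ?thesis
      using Edim_le_four_power enat by (simp add: enat_pow_def)
  \<comment> \<open>If the maximum is \<infinity>, so is the right-hand side.\<close>
  qed (simp add: enat_pow_def)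
qed

end
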